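(* A permutation $w\in\mathfrak{S}_n$ is unimodal if and only if it avoids both of the patterns $321$ and $3412$.
   Context: $\mathfrak{S}_n$ is the group of permutations of $\{1,\dots,n\}$. A permutation is called unimodal (after Edelman) if the underlying sets of the cycles in its disjoint cycle decomposition are (disjoint) intervals of consecutive integers and each cycle is unimodal. Here a cycle is unimodal if, when written as $(c_1\, c_2\,\cdots\, c_m)$ (meaning $c_1\mapsto c_2\mapsto\cdots\mapsto c_m\mapsto c_1$) with $c_1$ its smallest element, there is an index $r$ with $c_1<c_2<\cdots<c_r>c_{r+1}>\cdots>c_m$. For $p\in\mathfrak{S}_k$, the permutation $w$ contains the pattern $p$ if there are indices $i_1<\cdots<i_k$ such that $w(i_1)\cdots w(i_k)$ is in the same relative order as $p(1)\cdots p(k)$; otherwise $w$ avoids $p$. *)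

theory Defs
  imports "HOL-Combinatorics.Cycles"
begin

text \<open>
  An element of the symmetric group on \<open>{1, ..., n}\<close> is a function \<open>w\<close> with
  \<open>w permutes {1..n}\<close>.  For \<open>x\<close> in \<open>{1..n}\<close>, the list
  \<open>support w x = [x, w x, w (w x), ...]\<close> is the cycle of \<open>w\<close> through \<open>x\<close>, written
  starting from \<open>x\<close>; fixed points give cycles of length one.
\<close>

text \<open>
  A list \<open>[c1, ..., cm]\<close> denotes the cycle sending \<open>c1\<close> to \<open>c2\<close>, ..., \<open>cm\<close> to \<open>c1\<close>,
  so it may be rotated until its smallest entry comes first.  The peak, at the
  zero-based position \<open>r\<close>, belongs to both the increasing and the decreasing part.
\<close>

definition unimodal_cycle :: "nat list \<Rightarrow> bool" where
  "unimodal_cycle cs \<longleftrightarrow>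
     (\<exists>k ds. ds = rotate k cs \<and> (\<forall>x\<in>set ds. hd ds \<le> x) \<and>
        (\<exists>r<length ds. sorted_wrt (<) (take (Suc r) ds) \<and> sorted_wrt (>) (drop r ds)))"

definition unimodal_permutation :: "nat \<Rightarrow> (nat \<Rightarrow> nat) \<Rightarrow> bool" where
  "unimodal_permutation n w \<longleftrightarrow> w permutes {1..n} \<and>
     (\<forall>x\<in>{1..n}. (\<exists>a b. set (support w x) = {a..b}) \<and> unimodal_cycle (support w x))"

definition contains_pattern ::
    "nat \<Rightarrow> (nat \<Rightarrow> nat) \<Rightarrow> nat \<Rightarrow> (nat \<Rightarrow> nat) \<Rightarrow> bool" where
  "contains_pattern n w k p \<longleftrightarrow>
     (\<exists>i. strict_mono_on {1..k} i \<and> i ` {1..k} \<subseteq> {1..n} \<and>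
        (\<forall>a\<in>{1..k}. \<forall>b\<in>{1..k}. w (i a) < w (i b) \<longleftrightarrow> p a < p b))"

abbreviation avoids_pattern ::
    "nat \<Rightarrow> (nat \<Rightarrow> nat) \<Rightarrow> nat \<Rightarrow> (nat \<Rightarrow> nat) \<Rightarrow> bool" where
  "avoids_pattern n w k p \<equiv> \<not> contains_pattern n w k p"

text \<open>The permutation whose one-line notation is the given word; positions start at 1.\<close>

definition one_line :: "nat list \<Rightarrow> nat \<Rightarrow> nat" where
  "one_line xs i = (if i \<in> {1..length xs} then xs ! (i - 1) else i)"

end

theory Submission
  imports Defs
begin

text \<open>
  Both sides are equivalent to the following local condition: an excedance \<open>x\<close> never jumps over
  a later excedance, dually for anti-excedances, and no point jumps over a fixed point.  Avoidance gives this condition by a pigeonhole argument, since as many points cross a given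
  cut from left to right as from right to left.  Given the condition, a cycle started at its
  smallest element climbs until it meets its first anti-excedance.  It must then descend, because
  an excedance reached on the way down would be jumped over by the climb.  A missing
  value between minimum and maximum would likewise be jumped over.
\<close>

definition no_overjump :: "nat \<Rightarrow> (nat \<Rightarrow> nat) \<Rightarrow> bool" where
  "no_overjump n w \<longleftrightarrow> (\<forall>x\<in>{1..n}. \<forall>y\<in>{1..n}. x < y \<longrightarrow>
     (x < w x \<longrightarrow> y < w y \<longrightarrow> w x \<le> y) \<and> (w x < x \<longrightarrow> w y < y \<longrightarrow> x \<le> w y) \<and>
     (w y = y \<longrightarrow> w x < y) \<and> (w x = x \<longrightarrow> x < w y))"

section \<open>Pattern avoidance\<close>

lemma contains_321_iff:
  "contains_pattern n w 3 (one_line [3, 2, 1]) \<longleftrightarrow>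
     (\<exists>x\<in>{1..n}. \<exists>y\<in>{1..n}. \<exists>z\<in>{1..n}. x < y \<and> y < z \<and> w z < w y \<and> w y < w x)"
    (is "?L \<longleftrightarrow> ?R")
proof
  assume ?L
  then obtain i where i: "strict_mono_on {1..3::nat} i" "i ` {1..3} \<subseteq> {1..n}"
    "\<forall>a\<in>{1..3}. \<forall>b\<in>{1..3}. w (i a) < w (i b) \<longleftrightarrow> one_line [3, 2, 1] a < one_line [3, 2, 1] b"
    unfolding contains_pattern_def by blast
  have "i 1 < i 2" "i 2 < i 3"
    using i(1) by (auto simp: strict_mono_on_def)
  moreover have "w (i 3) < w (i 2)" "w (i 2) < w (i 1)"
    using i(3) by (auto simp: one_line_def)
  moreover have "i 1 \<in> {1..n}" "i 2 \<in> {1..n}" "i 3 \<in> {1..n}"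
    using i(2) by (auto simp: image_subset_iff)
  ultimately show ?R by blast
next
  assume ?R
  then obtain x y z where *: "x \<in> {1..n}" "y \<in> {1..n}" "z \<in> {1..n}" "x < y" "y < z"
    "w z < w y" "w y < w x" by blast
  have set: "{1..3} = {1, 2, 3::nat}" by auto
  show ?L
    unfolding contains_pattern_def set
    \<comment> \<open>\<open>one_line\<close> is reused here to turn the list of chosen positions
      into an index map; it is not meant as a permutation.\<close>
    by (rule exI[of _ "one_line [x, y, z]"]) (use * in \<open>auto simp: strict_mono_on_def one_line_def\<close>)
qed

lemma contains_3412_iff:
  "contains_pattern n w 4 (one_line [3, 4, 1, 2]) \<longleftrightarrow>
     (\<exists>x\<in>{1..n}. \<exists>y\<in>{1..n}. \<exists>z\<in>{1..n}. \<exists>u\<in>{1..n}.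
        x < y \<and> y < z \<and> z < u \<and> w z < w u \<and> w u < w x \<and> w x < w y)"
    (is "?L \<longleftrightarrow> ?R")
proof
  assume ?L
  then obtain i where i: "strict_mono_on {1..4::nat} i" "i ` {1..4} \<subseteq> {1..n}"
    "\<forall>a\<in>{1..4}. \<forall>b\<in>{1..4}. w (i a) < w (i b) \<longleftrightarrow> one_line [3, 4, 1, 2] a < one_line [3, 4, 1, 2] b"
    unfolding contains_pattern_def by blast
  have "i 1 < i 2" "i 2 < i 3" "i 3 < i 4"
    using i(1) by (auto simp: strict_mono_on_def)
  moreover have "w (i 3) < w (i 4)" "w (i 4) < w (i 1)" "w (i 1) < w (i 2)"
    using i(3) by (auto simp: one_line_def numeral_eq_Suc)
  moreover have "i 1 \<in> {1..n}" "i 2 \<in> {1..n}" "i 3 \<in> {1..n}" "i 4 \<in> {1..n}"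
    using i(2) by (auto simp: image_subset_iff)
  ultimately show ?R by blast
next
  assume ?R
  then obtain x y z u where *: "x \<in> {1..n}" "y \<in> {1..n}" "z \<in> {1..n}" "u \<in> {1..n}"
    "x < y" "y < z" "z < u" "w z < w u" "w u < w x" "w x < w y" by blast
  have set: "{1..4} = {1, 2, 3, 4::nat}" by auto
  show ?L
    unfolding contains_pattern_def set
    by (rule exI[of _ "one_line [x, y, z, u]"])
      (use * in \<open>auto simp: strict_mono_on_def one_line_def numeral_eq_Suc\<close>)
qed

section \<open>Crossings of a cut\<close>

text \<open>Since \<open>w\<close> maps the points with \<open>w x \<le> k\<close> bijectively onto
  the points \<open>x \<le> k\<close>, both sets have the same size. Removing the points that belong
  to both leaves the two kinds of crossing.\<close>

lemma card_crossings_eq: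
  fixes w :: "nat \<Rightarrow> nat"
  assumes "w permutes {1..n}"
  shows "card {x\<in>{1..n}. x \<le> k \<and> k < w x} = card {x\<in>{1..n}. k < x \<and> w x \<le> k}"
proof -
  have "w ` {x\<in>{1..n}. w x \<le> k} = {x\<in>{1..n}. x \<le> k}"
  proof -
    have "w ` {x\<in>{1..n}. w x \<le> k} = w ` {1..n} \<inter> {..k}" by auto
    then show ?thesis unfolding permutes_image[OF assms] by auto
  qed
  moreover have "inj_on w {x\<in>{1..n}. w x \<le> k}"
    using permutes_inj[OF assms] by (rule inj_on_subset) simp
  ultimately have "card {x\<in>{1..n}. x \<le> k} = card {x\<in>{1..n}. w x \<le> k}"
    by (metis card_image)
  moreover have "{x\<in>{1..n}. x \<le> k} = {x\<in>{1..n}. x \<le> k \<and> k < w x} \<union> {x\<in>{1..n}. x \<le> k \<and> w x \<le> k}"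
    "{x\<in>{1..n}. w x \<le> k} = {x\<in>{1..n}. k < x \<and> w x \<le> k} \<union> {x\<in>{1..n}. x \<le> k \<and> w x \<le> k}"
    by auto
  ultimately have "card ({x\<in>{1..n}. x \<le> k \<and> k < w x} \<union> {x\<in>{1..n}. x \<le> k \<and> w x \<le> k}) =
    card ({x\<in>{1..n}. k < x \<and> w x \<le> k} \<union> {x\<in>{1..n}. x \<le> k \<and> w x \<le> k})"
    by simp
  then show ?thesis
    by (subst (asm) (1 2) card_Un_disjoint) auto
qed

lemma ex_two_ordered_iff:
  fixes A :: "nat set"
  assumes "finite A"
  shows "2 \<le> card A \<longleftrightarrow> (\<exists>x\<in>A. \<exists>y\<in>A. x < y)"
proof -
  have "2 \<le> card A \<longleftrightarrow> \<not> card A \<le> Suc 0" by auto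
  also have "\<dots> \<longleftrightarrow> (\<exists>x\<in>A. \<exists>y\<in>A. x < y)"
    unfolding card_le_Suc0_iff_eq[OF assms] by (metis less_irrefl nat_neq_iff)
  finally show ?thesis .
qed

lemma two_crossings_iff:
  fixes w :: "nat \<Rightarrow> nat"
  assumes "w permutes {1..n}"
  shows "(\<exists>x\<in>{1..n}. \<exists>y\<in>{1..n}. x < y \<and> y \<le> k \<and> k < w x \<and> k < w y) \<longleftrightarrow>
    (\<exists>x\<in>{1..n}. \<exists>y\<in>{1..n}. k < x \<and> x < y \<and> w x \<le> k \<and> w y \<le> k)" (is "?L \<longleftrightarrow> ?R")
proof -
  have "?L \<longleftrightarrow> 2 \<le> card {x\<in>{1..n}. x \<le> k \<and> k < w x}"
    by (subst ex_two_ordered_iff) (force, fastforce)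
  also have "\<dots> \<longleftrightarrow> ?R"
    unfolding card_crossings_eq[OF assms] by (subst ex_two_ordered_iff) (force, fastforce)
  finally show ?thesis .
qed

lemma avoids_imp_no_overjump:
  assumes w: "w permutes {1..n}"
    and 321: "avoids_pattern n w 3 (one_line [3, 2, 1])"
    and 3412: "avoids_pattern n w 4 (one_line [3, 4, 1, 2])"
  shows "no_overjump n w"
  unfolding no_overjump_def
proof (intro ballI impI conjI)
  have inj: "w x \<noteq> w y" if "x < y" for x y
    using permutes_inj[OF w] that by (metis injD less_irrefl)
  have no321: False if "x \<in> {1..n}" "y \<in> {1..n}" "z \<in> {1..n}" "x < y" "y < z" "w z < w y" "w y < w x"
    for x y z using 321 that unfolding contains_321_iff by blast
  have no3412: False if "x \<in> {1..n}" "y \<in> {1..n}" "z \<in> {1..n}" "u \<in> {1..n}"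
    "x < y" "y < z" "z < u" "w z < w u" "w u < w x" "w x < w y"
    for x y z u using 3412 that unfolding contains_3412_iff by blast
  \<comment> \<open>Two crossings of the cut after \<open>k\<close> in each direction always produce
    a pattern: 321 if the left pair or the right pair is inverted (add one point from the other
    side), and 3412 if neither is.\<close>
  have no_two: False if *: "x \<in> {1..n}" "y \<in> {1..n}" "z \<in> {1..n}" "u \<in> {1..n}"
    "x < y" "y \<le> k" "k < z" "z < u" "k < w x" "k < w y" "w z \<le> k" "w u \<le> k" for k x y z u
  proof -
    consider "w y < w x" | "w u < w z" | "w x < w y" "w z < w u"
      using inj[of x y] inj[of z u] * by linarith
    then show False
      using no321[of x y z] no321[of x z u] no3412[of x y z u] * by cases auto
  qed
  fix x y assume xy: "x \<in> {1..n}" "y \<in> {1..n}" "x < y"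
  show "w x \<le> y" if "x < w x" "y < w y"
  proof (rule ccontr)
    assume "\<not> w x \<le> y"
    \<comment> \<open>The cut is placed right after \<open>y\<close>: both \<open>x\<close> and
      \<open>y\<close> cross it to the right, so two points must cross back.\<close>
    with that xy have "\<exists>z\<in>{1..n}. \<exists>u\<in>{1..n}. y < z \<and> z < u \<and> w z \<le> y \<and> w u \<le> y"
      by (subst two_crossings_iff[OF w, symmetric]) (use linorder_not_le in blast)
    then obtain z u where "z \<in> {1..n}" "u \<in> {1..n}" "y < z" "z < u" "w z \<le> y" "w u \<le> y"
      by blast
    with no_two[of x y z u y] xy that \<open>\<not> w x \<le> y\<close> show False by auto
  qed
  show "x \<le> w y" if "w x < x" "w y < y"
  proof (rule ccontr)
    assume "\<not> x \<le> w y"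
    \<comment> \<open>The cut is placed just before \<open>x\<close>, after \<open>x - 1\<close>:
      both \<open>x\<close> and \<open>y\<close> cross it to the left.\<close>
    with that xy have *: "x - 1 < x" "x < y" "w x \<le> x - 1" "w y \<le> x - 1" by auto
    with xy have "\<exists>z\<in>{1..n}. \<exists>u\<in>{1..n}. z < u \<and> u \<le> x - 1 \<and> x - 1 < w z \<and> x - 1 < w u"
      by (subst two_crossings_iff[OF w]) blast
    then obtain z u where "z \<in> {1..n}" "u \<in> {1..n}" "z < u" "u \<le> x - 1" "x - 1 < w z" "x - 1 < w u"
      by blast
    with no_two[of z u x y "x - 1"] xy * show False by blast
  qed
  show "w x < y" if "w y = y"
  proof (rule ccontr)
    assume "\<not> w x < y"
    with inj[OF xy(3)] that have "y < w x" by simp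
    \<comment> \<open>One crossing back suffices here: some \<open>z\<close> beyond \<open>y\<close>
      lands below the fixed point, and \<open>x\<close>, \<open>y\<close>, \<open>z\<close> form
      321.\<close>
    with xy have "card {x\<in>{1..n}. x \<le> y \<and> y < w x} \<noteq> 0"
      by (subst card_0_eq) (simp, blast intro: less_imp_le)
    then have "{x\<in>{1..n}. y < x \<and> w x \<le> y} \<noteq> {}"
      by (metis card.empty card_crossings_eq[OF w])
    then obtain z where "z \<in> {1..n}" "y < z" "w z \<le> y" by blast
    with inj[of y z] no321[of x y z] xy that \<open>y < w x\<close> show False by auto
  qed
  show "x < w y" if "w x = x"
  proof (rule ccontr)
    assume "\<not> x < w y"
    with inj[OF xy(3)] that have "w y < x" by simp
    \<comment> \<open>The mirror image: \<open>y\<close> crosses to the left of \<open>x\<close>, so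
      some \<open>z\<close> below \<open>x\<close> crosses to its right, and \<open>z\<close>,
      \<open>x\<close>, \<open>y\<close> form 321.\<close>
    with xy have "card {z\<in>{1..n}. x < z \<and> w z \<le> x} \<noteq> 0"
      by (subst card_0_eq) (simp, blast intro: less_imp_le)
    then have "{z\<in>{1..n}. z \<le> x \<and> x < w z} \<noteq> {}"
      by (metis card.empty card_crossings_eq[OF w])
    then obtain z where "z \<in> {1..n}" "z \<le> x" "x < w z" by blast
    with no321[of z x y] xy that \<open>w y < x\<close> show False
      by (cases "z = x") auto
  qed
qed

text \<open>Every inversion leads from an excedance to an anti-excedance. The middle point of a 321
  would have to be both. In a 3412 at \<open>x < y < z < u\<close> the first two points are
  excedances and the last two anti-excedances, so \<open>w x \<le> y < z \<le> w u\<close>, against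
  \<open>w u < w x\<close>.\<close>

lemma no_overjump_imp_avoids:
  assumes "no_overjump n w"
  shows "avoids_pattern n w 3 (one_line [3, 2, 1]) \<and> avoids_pattern n w 4 (one_line [3, 4, 1, 2])"
proof -
  have up: "w x \<le> y" if "x \<in> {1..n}" "y \<in> {1..n}" "x < y" "x < w x" "y < w y" for x y
    using assms that unfolding no_overjump_def by blast
  have down: "x \<le> w y" if "x \<in> {1..n}" "y \<in> {1..n}" "x < y" "w x < x" "w y < y" for x y
    using assms that unfolding no_overjump_def by blast
  have fix_pt: "w x < y" if "x \<in> {1..n}" "y \<in> {1..n}" "x < y" "w y = y" for x y
    using assms that unfolding no_overjump_def by blast
  have fix_pt': "x < w y" if "x \<in> {1..n}" "y \<in> {1..n}" "x < y" "w x = x" for x y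
    using assms that unfolding no_overjump_def by blast
  have inversion: "x < w x \<and> w y < y"
    if "x \<in> {1..n}" "y \<in> {1..n}" "x < y" "w y < w x" for x y
  proof -
    \<comment> \<open>If \<open>y\<close> were fixed or an excedance, \<open>w y < w x\<close> would
      put \<open>w x\<close> beyond \<open>y\<close>, against \<open>fix_pt\<close> or
      \<open>up\<close>. The argument for \<open>x\<close> is the mirror image.\<close>
    have "w y \<noteq> y" using fix_pt[of x y] that by auto
    moreover have "\<not> y < w y" using up[of x y] that by auto
    ultimately have "w y < y" by simp
    moreover have "w x \<noteq> x" using fix_pt'[of x y] that by auto
    moreover from \<open>w y < y\<close> have "\<not> w x < x" using down[of x y] that by auto
    ultimately show ?thesis by simp
  qed
  show ?thesis
    unfolding contains_321_iff contains_3412_iff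
  proof (intro conjI notI; elim bexE conjE)
    fix x y z assume "x \<in> {1..n}" "y \<in> {1..n}" "z \<in> {1..n}" "x < y" "y < z" "w z < w y" "w y < w x"
    with inversion[of x y] inversion[of y z] show False by simp
  next
    fix x y z u assume *: "x \<in> {1..n}" "y \<in> {1..n}" "z \<in> {1..n}" "u \<in> {1..n}"
      "x < y" "y < z" "z < u" "w z < w u" "w u < w x" "w x < w y"
    with inversion[of x z] inversion[of y u]
    have "x < w x" "y < w y" "w z < z" "w u < u" by simp_all
    with up[of x y] down[of z u] * show False by simp
  qed
qed

section \<open>Cycles\<close>

text \<open>The equation \<open>map w cs = rotate1 cs\<close> is how cycles are described from here
  on. It survives rotation, so it still holds once the smallest entry has been moved to the
  front.\<close>

lemma support_cycle:
  assumes "permutation w"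
  shows "x \<in> set (support w x)" "distinct (support w x)" "map w (support w x) = rotate1 (support w x)"
proof -
  show "x \<in> set (support w x)"
    using least_power_of_permutation(2)[OF assms] by force
  show "distinct (support w x)"
    by (rule cycle_of_permutation[OF assms])
  have "map w (support w x) = map (cycle_of_list (support w x)) (support w x)"
    by (rule map_cong[OF refl]) (rule cycle_restrict[OF assms])
  also have "\<dots> = rotate1 (support w x)"
    using cyclic_rotation[OF cycle_of_permutation[OF assms], of 1 x] by simp
  finally show "map w (support w x) = rotate1 (support w x)" .
qed

lemma map_eq_rotate1_nth:
  assumes "map w ds = rotate1 ds" "i < length ds"
  shows "w (ds ! i) = (if Suc i < length ds then ds ! Suc i else hd ds)"
proof -
  have "w (ds ! i) = ds ! (Suc i mod length ds)"
    using assms by (metis nth_map nth_rotate1)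
  then show ?thesis
    using assms(2) by (cases "ds = []") (auto simp: mod_Suc hd_conv_nth)
qed

lemma map_eq_rotate1_closed:
  assumes "map w ds = rotate1 ds" "x \<in> set ds"
  shows "w x \<in> set ds"
  using assms by (metis image_eqI set_map set_rotate1)

text \<open>Distinctness rules out a successor inside the list, so the fixed point stands last. Its
  image is then the head, so the last position is also the first.\<close>

lemma map_eq_rotate1_fixpoint:
  assumes "map w ds = rotate1 ds" "distinct ds" "x \<in> set ds" "w x = x"
  shows "ds = [x]"
proof -
  obtain j where j: "j < length ds" "x = ds ! j"
    using assms(3) by (auto simp: in_set_conv_nth)
  have hd: "hd ds = ds ! 0" using j by (intro hd_conv_nth) auto
  have "\<not> Suc j < length ds"
    using map_eq_rotate1_nth[OF assms(1) j(1)] j assms(2,4) nth_eq_iff_index_eq[of ds "Suc j" j] by auto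
  moreover from this have "j = 0"
    using map_eq_rotate1_nth[OF assms(1) j(1)] j hd assms(4) nth_eq_iff_index_eq[OF assms(2), of 0 j]
    by (cases ds) auto
  ultimately show ?thesis
    using j by (cases ds) auto
qed

section \<open>From unimodal cycles to the local condition\<close>

locale unimodal_list =
  fixes w :: "nat \<Rightarrow> nat" and ds :: "nat list" and r :: nat
  assumes cycle: "map w ds = rotate1 ds" "distinct ds"
    and hd_le: "\<And>x. x \<in> set ds \<Longrightarrow> hd ds \<le> x"
    and r: "r < length ds"
    and climb: "sorted_wrt (<) (take (Suc r) ds)"
    and descent: "sorted_wrt (>) (drop r ds)"
begin

lemma climb_less: "i < j \<Longrightarrow> j \<le> r \<Longrightarrow> ds ! i < ds ! j"
  using sorted_wrt_nth_less[OF climb, of i j] r by simp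

lemma descent_less: "r \<le> i \<Longrightarrow> i < j \<Longrightarrow> j < length ds \<Longrightarrow> ds ! j < ds ! i"
  using sorted_wrt_nth_less[OF descent, of "i - r" "j - r"] by simp

text \<open>Steps before position \<open>r\<close> climb and later ones descend; the last entry is
  sent to \<open>hd ds\<close>, which exceeds no entry.\<close>

lemma excedance_iff: "i < length ds \<Longrightarrow> ds ! i < w (ds ! i) \<longleftrightarrow> i < r"
  using climb_less[of i "Suc i"] descent_less[of i "Suc i"] hd_le[of "ds ! i"] r
  by (cases "i < r") (auto simp: map_eq_rotate1_nth[OF cycle(1)] not_less)

text \<open>Both points lie on the climb, \<open>x\<close> earlier than \<open>y\<close>, and
  \<open>w x\<close> is the next entry after \<open>x\<close>, hence at most
  \<open>y\<close>.\<close>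

lemma excedance_le:
  assumes "x \<in> set ds" "y \<in> set ds" "x < y" "x < w x" "y < w y"
  shows "w x \<le> y"
proof -
  obtain i j where ij: "i < length ds" "x = ds ! i" "j < length ds" "y = ds ! j"
    using assms by (auto simp: in_set_conv_nth)
  with assms have "i < r" "j < r" by (simp_all add: excedance_iff)
  moreover from this have "i < j"
    using climb_less[of j i] ij \<open>x < y\<close> by (metis less_imp_le not_less_iff_gr_or_eq)
  ultimately show ?thesis
    using ij climb_less[of "Suc i" j] map_eq_rotate1_nth[OF cycle(1) ij(1)]
    by (cases "Suc i = j") auto
qed

text \<open>On the descent the larger point \<open>y\<close> comes first, so its successor
  \<open>w y\<close> has not yet passed \<open>x\<close>.\<close>

lemma anti_excedance_ge:
  assumes "x \<in> set ds" "y \<in> set ds" "x < y" "w x < x" "w y < y"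
  shows "x \<le> w y"
proof -
  obtain i j where ij: "i < length ds" "x = ds ! i" "j < length ds" "y = ds ! j"
    using assms by (auto simp: in_set_conv_nth)
  with assms have "r \<le> i" "r \<le> j"
    using excedance_iff[of i] excedance_iff[of j] by auto
  moreover from this have "j < i"
    using descent_less[of i j] ij \<open>x < y\<close> by (metis less_imp_le not_less_iff_gr_or_eq)
  ultimately show ?thesis
    using ij descent_less[of "Suc j" i] map_eq_rotate1_nth[OF cycle(1) ij(3)]
    by (cases "Suc j = i") auto
qed

lemma fixpoint_unique: "x \<in> set ds \<Longrightarrow> y \<in> set ds \<Longrightarrow> w y = y \<Longrightarrow> x = y"
  using map_eq_rotate1_fixpoint[OF cycle] by (metis empty_iff insert_iff list.set)

end

text \<open>If one of the two cycle intervals contains both points, the lemmas on a single cycle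
  apply. Otherwise each point stays within its own interval, which cannot reach across the other
  point.\<close>

lemma unimodal_imp_no_overjump:
  assumes uni: "unimodal_permutation n w"
  shows "no_overjump n w"
proof -
  have perm: "permutation w"
    using uni unfolding unimodal_permutation_def permutation_permutes by blast
  \<comment> \<open>Within one cycle the fixed point clauses become vacuous: a cycle with two
    different points has no fixed point.\<close>
  have block: "\<exists>S a b. x \<in> S \<and> S = {a..b} \<and> (\<forall>z\<in>S. w z \<in> S) \<and>
    (\<forall>x\<in>S. \<forall>y\<in>S. x < y \<longrightarrow> (x < w x \<longrightarrow> y < w y \<longrightarrow> w x \<le> y) \<and>
       (w x < x \<longrightarrow> w y < y \<longrightarrow> x \<le> w y) \<and> w x \<noteq> x \<and> w y \<noteq> y)" if x: "x \<in> {1..n}" for x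
  proof -
    obtain a b k r where ab: "set (support w x) = {a..b}" and
      ds: "\<forall>z\<in>set (rotate k (support w x)). hd (rotate k (support w x)) \<le> z"
      "r < length (rotate k (support w x))"
      "sorted_wrt (<) (take (Suc r) (rotate k (support w x)))"
      "sorted_wrt (>) (drop r (rotate k (support w x)))"
      using uni x unfolding unimodal_permutation_def unimodal_cycle_def by metis
    have map_eq: "map w (rotate k (support w x)) = rotate1 (rotate k (support w x))"
      by (metis support_cycle(3)[OF perm] rotate_map rotate1_rotate_swap)
    interpret unimodal_list w "rotate k (support w x)" r
      using ds map_eq support_cycle(2)[OF perm] by unfold_locales auto
    let ?S = "set (rotate k (support w x))"
    have S: "?S = {a..b}"
      using ab by (simp only: set_rotate)
    have mem: "x \<in> ?S"
      using support_cycle(1)[OF perm, of x] by (simp only: set_rotate)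
    have closed: "\<forall>z\<in>?S. w z \<in> ?S"
      using map_eq_rotate1_closed[OF map_eq] by blast
    have "\<forall>x\<in>?S. \<forall>y\<in>?S. x < y \<longrightarrow> (x < w x \<longrightarrow> y < w y \<longrightarrow> w x \<le> y) \<and>
       (w x < x \<longrightarrow> w y < y \<longrightarrow> x \<le> w y) \<and> w x \<noteq> x \<and> w y \<noteq> y"
    proof (intro ballI impI)
      fix x y assume "x \<in> ?S" "y \<in> ?S" "x < y"
      then show "(x < w x \<longrightarrow> y < w y \<longrightarrow> w x \<le> y) \<and>
        (w x < x \<longrightarrow> w y < y \<longrightarrow> x \<le> w y) \<and> w x \<noteq> x \<and> w y \<noteq> y"
        using excedance_le[of x y] anti_excedance_ge[of x y] fixpoint_unique[of x y]
          fixpoint_unique[of y x] by (metis less_irrefl)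
    qed
    with S mem closed show ?thesis by blast
  qed
  show ?thesis
    unfolding no_overjump_def
  proof (intro ballI impI)
    fix x y assume xy: "x \<in> {1..n}" "y \<in> {1..n}" "x < y"
    from block[OF xy(1)] obtain S a b where S: "x \<in> S" "S = {a..b}" "\<forall>z\<in>S. w z \<in> S"
      "\<forall>x\<in>S. \<forall>y\<in>S. x < y \<longrightarrow> (x < w x \<longrightarrow> y < w y \<longrightarrow> w x \<le> y) \<and>
         (w x < x \<longrightarrow> w y < y \<longrightarrow> x \<le> w y) \<and> w x \<noteq> x \<and> w y \<noteq> y" by metis
    from block[OF xy(2)] obtain T c d where T: "y \<in> T" "T = {c..d}" "\<forall>z\<in>T. w z \<in> T"
      "\<forall>x\<in>T. \<forall>y\<in>T. x < y \<longrightarrow> (x < w x \<longrightarrow> y < w y \<longrightarrow> w x \<le> y) \<and>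
         (w x < x \<longrightarrow> w y < y \<longrightarrow> x \<le> w y) \<and> w x \<noteq> x \<and> w y \<noteq> y" by metis
    have "w x < y" if "y \<notin> S"
    proof -
      have "w x \<in> S" using S(1,3) by blast
      with that S(1,2) xy(3) show ?thesis by auto
    qed
    moreover have "x < w y" if "x \<notin> T"
    proof -
      have "w y \<in> T" using T(1,3) by blast
      with that T(1,2) xy(3) show ?thesis by auto
    qed
    ultimately show "(x < w x \<longrightarrow> y < w y \<longrightarrow> w x \<le> y) \<and> (w x < x \<longrightarrow> w y < y \<longrightarrow> x \<le> w y) \<and>
      (w y = y \<longrightarrow> w x < y) \<and> (w x = x \<longrightarrow> x < w y)"
      using S(1,4) T(1,4) xy(3) by (metis less_imp_le)
  qed
qed

section \<open>From the local condition to unimodal cycles\<close>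

text \<open>A discrete intermediate value principle. The general order type allows it to be applied
  to a negated integer sequence as well, where it finds a downward step.\<close>

lemma ex_upward_step:
  fixes f :: "nat \<Rightarrow> 'a::linorder"
  assumes "f i \<le> y" "y < f j" "i \<le> j"
  obtains k where "i \<le> k" "k < j" "f k \<le> y" "y < f (Suc k)"
proof -
  have "\<exists>k. i \<le> k \<and> k < j \<and> f k \<le> y \<and> y < f (Suc k)"
    using assms(3,2)
  proof (induction j rule: dec_induct)
    case base
    with assms(1) show ?case by simp
  next
    case (step j)
    then show ?case by (cases "y < f j") (use less_Suc_eq in \<open>auto simp: not_less\<close>)
  qed
  with that show ?thesis by blast
qed

locale no_overjump_cycle =
  fixes n :: nat and w :: "nat \<Rightarrow> nat" and ds :: "nat list"
  assumes no_overjump: "no_overjump n w"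
    and cycle: "map w ds = rotate1 ds" "distinct ds"
    and hd_le: "\<And>x. x \<in> set ds \<Longrightarrow> hd ds \<le> x"
    and subset: "set ds \<subseteq> {1..n}"
    and ne: "ds \<noteq> []"
begin

text \<open>The end of the climb, to serve as the index \<open>r\<close> of a unimodal cycle. The
  weak inequality also gives a cycle of length one its peak, at position 0.\<close>

definition peak :: nat where
  "peak = (LEAST i. w (ds ! i) \<le> ds ! i)"

lemma w_nth: "i < length ds \<Longrightarrow> w (ds ! i) = (if Suc i < length ds then ds ! Suc i else hd ds)"
  by (rule map_eq_rotate1_nth[OF cycle(1)])

lemma
  shows peak_less: "peak < length ds"
    and peak: "w (ds ! peak) \<le> ds ! peak"
proof -
  have last: "length ds - 1 < length ds" using ne by simp
  \<comment> \<open>The last entry is sent to the minimum \<open>hd ds\<close>, so it is no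
    excedance and witnesses that the \<open>LEAST\<close> exists.\<close>
  have le: "w (ds ! (length ds - 1)) \<le> ds ! (length ds - 1)"
    using w_nth[OF last] hd_le[OF nth_mem[OF last]] ne by simp
  then show "w (ds ! peak) \<le> ds ! peak"
    unfolding peak_def by (rule LeastI)
  have "peak \<le> length ds - 1"
    unfolding peak_def using le by (rule Least_le)
  with last show "peak < length ds" by simp
qed

lemma before_peak: "i < peak \<Longrightarrow> ds ! i < w (ds ! i) \<and> w (ds ! i) = ds ! Suc i"
  using not_less_Least[of i "\<lambda>i. w (ds ! i) \<le> ds ! i"] peak_less w_nth[of i]
  unfolding peak_def[symmetric] by simp

lemma climb_mono: "i < j \<Longrightarrow> j \<le> peak \<Longrightarrow> ds ! i < ds ! j"
proof (induction j)
  case (Suc j)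
  then show ?case using before_peak[of j] by (cases "i = j") auto
qed simp

lemma not_fixpoint:
  assumes "1 < length ds" "x \<in> set ds"
  shows "w x \<noteq> x"
proof
  assume "w x = x"
  then have "ds = [x]"
    using map_eq_rotate1_fixpoint[OF cycle assms(2)] by blast
  with assms(1) show False by simp
qed

text \<open>The climb starts at or below \<open>y\<close>, ends above it and never lands on it, so
  one of its steps passes strictly over \<open>y\<close>.\<close>

lemma jump_over:
  assumes "ds ! 0 \<le> y" "y < ds ! peak" "y \<notin> (!) ds ` {..<peak}"
  obtains x where "x \<in> {1..n}" "x < y" "x < w x" "y < w x"
proof -
  obtain k where k: "k < peak" "ds ! k \<le> y" "y < ds ! Suc k"
    using ex_upward_step[of "(!) ds" 0 y peak] assms by auto
  moreover have "ds ! k \<noteq> y" using k(1) assms(3) by auto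
  moreover have "ds ! k \<in> {1..n}" using subset k(1) peak_less by (meson less_trans nth_mem subsetD)
  ultimately show ?thesis using before_peak[of k] by (intro that[of "ds ! k"]) auto
qed

text \<open>By distinctness an entry after the peak is not on the climb; if it were an excedance, a
  step of the climb would jump over it. The bound by the peak is carried through the induction
  because \<open>jump_over\<close> needs it.\<close>

lemma after_peak:
  assumes "1 < length ds" "peak \<le> j" "j < length ds"
  shows "w (ds ! j) < ds ! j \<and> ds ! j \<le> ds ! peak"
  using assms(2,3)
proof (induction j rule: dec_induct)
  case base
  then show ?case using peak not_fixpoint[OF assms(1), of "ds ! peak"] by (simp add: order_less_le)
next
  case (step j)
  let ?y = "ds ! Suc j"
  have mem: "?y \<in> set ds" using step by simp
  have less: "?y < ds ! peak" using step w_nth[of j] by simp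
  have "\<not> ?y < w ?y"
  proof
    assume exc: "?y < w ?y"
    have "ds ! 0 \<le> ?y" using hd_le[OF mem] ne by (simp add: hd_conv_nth)
    moreover have "?y \<notin> (!) ds ` {..<peak}"
      using step cycle(2) peak_less by (auto simp: nth_eq_iff_index_eq)
    ultimately obtain x where "x \<in> {1..n}" "x < ?y" "x < w x" "?y < w x"
      using jump_over less by blast
    with exc mem subset no_overjump show False
      unfolding no_overjump_def by (meson not_le subsetD)
  qed
  with not_fixpoint[OF assms(1) mem] less show ?case by simp
qed

lemma descent_mono:
  assumes "peak \<le> i" "i < j" "j < length ds"
  shows "ds ! j < ds ! i"
  using assms(2,3)
proof (induction j)
  case (Suc j)
  with assms(1) after_peak[of j] w_nth[of j] show ?case by (cases "i = j") auto
qed simp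

lemma unimodal: "peak < length ds \<and> sorted_wrt (<) (take (Suc peak) ds) \<and> sorted_wrt (>) (drop peak ds)"
  using peak_less climb_mono descent_mono by (auto simp: sorted_wrt_iff_nth_less)

lemma nth_le_peak:
  assumes "j < length ds"
  shows "ds ! j \<le> ds ! peak"
  using climb_mono[of j peak] descent_mono[of peak j] assms
  by (cases j peak rule: linorder_cases) auto

text \<open>A missing value \<open>y\<close> is passed over by both the climb and the descent. The
  climb forces \<open>w y < y\<close>, and then the step of the descent over \<open>y\<close> is
  forbidden.\<close>

lemma between_mem:
  assumes "hd ds \<le> y" "y \<le> ds ! peak"
  shows "y \<in> set ds"
proof (rule ccontr)
  assume notin: "y \<notin> set ds"
  then have less: "y < ds ! peak"
    using assms(2) peak_less by (metis le_neq_implies_less nth_mem)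
  have "(!) ds ` {..<peak} \<subseteq> set ds" using peak_less by auto
  with notin have "y \<notin> (!) ds ` {..<peak}" by blast
  then obtain x where x: "x \<in> {1..n}" "x < y" "x < w x" "y < w x"
    using jump_over[of y] assms(1) less hd_conv_nth[OF ne] by metis
  have peak_mem: "ds ! peak \<in> {1..n}" using subset peak_less by (meson nth_mem subsetD)
  have y: "y \<in> {1..n}" using x less peak_mem by auto
  \<comment> \<open>As \<open>x\<close> jumps over it, \<open>y\<close> is neither fixed nor an
    excedance.\<close>
  have "w y < y"
    using no_overjump x y unfolding no_overjump_def by (meson leD linorder_neqE_nat order_less_trans)
  \<comment> \<open>\<open>c\<close> extends the list by one position, \<open>length ds\<close>,
    which stands for the return to \<open>hd ds\<close>, so that the closing step of the cycle is
    covered too.\<close>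
  define c where "c i = (if i < length ds then ds ! i else hd ds)" for i
  have "hd ds < y" using assms(1) notin hd_in_set[OF ne] le_neq_implies_less by blast
  \<comment> \<open>the descent from the peak back to \<open>hd ds\<close> jumps over \<open>y\<close>\<close>
  with less peak_less obtain k where k: "peak \<le> k" "k < length ds" "y \<le> c k" "c (Suc k) < y"
    using ex_upward_step[of "\<lambda>i. - int (c i)" peak "- int y" "length ds"] by (auto simp: c_def)
  have "w (ds ! k) < y" using k w_nth[of k] by (simp add: c_def)
  moreover have "y < ds ! k" using k notin nth_mem[of k ds] by (auto simp: c_def order_less_le)
  moreover have "ds ! k \<in> {1..n}" using subset k(2) by (meson nth_mem subsetD)
  ultimately show False
    using no_overjump y \<open>w y < y\<close> unfolding no_overjump_def by (meson leD order_less_trans)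
qed

lemma set_eq_interval: "set ds = {hd ds..ds ! peak}"
  using hd_le nth_le_peak between_mem by (auto simp: in_set_conv_nth)

end

lemma no_overjump_imp_unimodal:
  assumes w: "w permutes {1..n}" and "no_overjump n w"
  shows "unimodal_permutation n w"
  unfolding unimodal_permutation_def
proof (intro conjI ballI w)
  have perm: "permutation w"
    using w unfolding permutation_permutes by blast
  fix x assume x: "x \<in> {1..n}"
  let ?cs = "support w x"
  have ne: "?cs \<noteq> []"
    using support_cycle(1)[OF perm, of x] by (metis empty_iff list.set(1))
  \<comment> \<open>Rotating by the position of the minimum brings it to the front.\<close>
  obtain k where k: "k < length ?cs" "?cs ! k = Min (set ?cs)"
    using Min_in[of "set ?cs"] ne by (metis List.finite_set in_set_conv_nth set_empty)
  define ds where "ds = rotate k ?cs"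
  have set: "set ds = set ?cs" by (simp add: ds_def)
  have hd: "hd ds = Min (set ds)"
    using hd_rotate_conv_nth[OF ne, of k] k set by (simp only: ds_def mod_less)
  interpret no_overjump_cycle n w ds
  proof
    show "no_overjump n w" by fact
    show "map w ds = rotate1 ds"
      unfolding ds_def by (metis support_cycle(3)[OF perm] rotate_map rotate1_rotate_swap)
    show "distinct ds" using support_cycle(2)[OF perm] by (simp only: ds_def distinct_rotate)
    show "hd ds \<le> z" if "z \<in> set ds" for z using that hd by simp
    show "set ds \<subseteq> {1..n}"
      \<comment> \<open>The entries of \<open>support w x\<close> are iterates of \<open>w\<close>
        at \<open>x\<close>, and powers of \<open>w\<close> permute the same set.\<close>
      using x permutes_in_image[OF permutes_funpow[OF w]] unfolding set by auto
    show "ds \<noteq> []" using ne unfolding ds_def rotate_is_Nil_conv .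
  qed
  show "\<exists>a b. set ?cs = {a..b}"
    using set_eq_interval set by metis
  show "unimodal_cycle ?cs"
    unfolding unimodal_cycle_def using ds_def hd_le unimodal by blast
qed

theorem corollary4p12:
  fixes n :: nat and w :: "nat \<Rightarrow> nat"
  assumes "w permutes {1..n}"
  shows "unimodal_permutation n w \<longleftrightarrow>
    avoids_pattern n w 3 (one_line [3, 2, 1]) \<and> avoids_pattern n w 4 (one_line [3, 4, 1, 2])"
  using assms unimodal_imp_no_overjump no_overjump_imp_unimodal
    avoids_imp_no_overjump no_overjump_imp_avoids by blast

end
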